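(* Any online learning algorithm for the experts problem with $n$ experts that obtains $o(T)$ regret over $T$ days against a strong adaptive adversary requires $\Omega(n)$ space.
   Context: Online learning with expert advice: there are $n$ experts and $T$ days. On day $t$ the algorithm, based on its memory state, specifies a strategy $p_t\in\Delta_n$ (a probability distribution over $[n]$) and plays $i_t\sim p_t$; then a loss vector $\ell_t\in[0,1]^n$ is revealed, the algorithm incurs $\ell_t(i_t)$, observes $\ell_t$, and updates its memory state. Space is the maximum size of the memory state kept between days. A strong adaptive adversary may choose $\ell_t$ depending on the algorithm's current-round strategy $p_t$ (as well as the past). Regret is $\mathbb{E}\left[\sum_t\ell_t(i_t) - \min_{i^*\in[n]}\sum_t\ell_t(i^* )\right]$. *)

theory Defs
  imports "HOL-Probability.Probability" "HOL-Library.Landau_Symbols"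
begin

text \<open>
  The \<open>n\<close> experts are \<open>0, \<dots>, n - 1\<close> and days are numbered from \<open>0\<close>.
  A strategy, i.e. an element of the simplex, is a \<open>nat pmf\<close> supported on \<open>{..<n}\<close>.
\<close>

type_synonym loss = "nat \<Rightarrow> real"

definition losses :: "nat \<Rightarrow> loss set" where
  "losses n = {..<n} \<rightarrow>\<^sub>E {0..1}"

text \<open>
  Memory states are bit strings. The only information carried from one day to the next is the
  memory state; the day number is available for free. Fresh coins may be tossed at any point: in
  the initial state, in the choice of the strategy (which then depends on the day and the memory
  state only; an algorithm whose strategy is a function of its memory state uses
  \<open>return_pmf\<close> here), and in the update. The update sees the old memory state, the
  strategy, the expert played and the loss vector.
\<close>

record algorithm =
  init :: "bool list pmf"
  strategy :: "nat \<Rightarrow> bool list \<Rightarrow> nat pmf pmf"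
  update :: "nat \<Rightarrow> bool list \<Rightarrow> nat pmf \<Rightarrow> nat \<Rightarrow> loss \<Rightarrow> bool list pmf"

definition experts_algorithm :: "nat \<Rightarrow> algorithm \<Rightarrow> bool" where
  "experts_algorithm n A \<longleftrightarrow>
     (\<forall>t m. \<forall>p \<in> set_pmf (strategy A t m). set_pmf p \<subseteq> {..<n})"

text \<open>A transcript lists, oldest day first, the strategy, the expert played and the loss vector.\<close>

type_synonym transcript = "(nat pmf \<times> nat \<times> loss) list"

text \<open>
  A strong adaptive adversary picks the loss vector from the transcript of the past days and the
  strategy of the current day, but not from the expert drawn on the current day.
\<close>

type_synonym adversary = "transcript \<Rightarrow> nat pmf \<Rightarrow> loss"

definition strong_adaptive_adversaries :: "nat \<Rightarrow> adversary set" where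
  "strong_adaptive_adversaries n = {adv. \<forall>h p. adv h p \<in> losses n}"

text \<open>Joint law of the memory state and the transcript after the given number of days.\<close>

primrec run :: "algorithm \<Rightarrow> adversary \<Rightarrow> nat \<Rightarrow> (bool list \<times> transcript) pmf" where
  "run A adv 0 = map_pmf (\<lambda>m. (m, [])) (init A)"
| "run A adv (Suc t) =
     bind_pmf (run A adv t) (\<lambda>(m, h).
     bind_pmf (strategy A t m) (\<lambda>p.
     bind_pmf p (\<lambda>i.
     map_pmf (\<lambda>m'. (m', h @ [(p, i, adv h p)])) (update A t m p i (adv h p)))))"

definition algorithm_loss :: "transcript \<Rightarrow> real" where
  "algorithm_loss h = (\<Sum>(p, i, l)\<leftarrow>h. l i)"

definition expert_loss :: "transcript \<Rightarrow> nat \<Rightarrow> real" where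
  "expert_loss h j = (\<Sum>(p, i, l)\<leftarrow>h. l j)"

definition regret :: "nat \<Rightarrow> nat \<Rightarrow> algorithm \<Rightarrow> adversary \<Rightarrow> real" where
  "regret n T A adv = measure_pmf.expectation (run A adv T)
     (\<lambda>(m, h). algorithm_loss h - Min (expert_loss h ` {..<n}))"

text \<open>\<open>memory_states n A t\<close>: the memory states with which day \<open>t\<close> may start.\<close>

primrec memory_states :: "nat \<Rightarrow> algorithm \<Rightarrow> nat \<Rightarrow> bool list set" where
  "memory_states n A 0 = set_pmf (init A)"
| "memory_states n A (Suc t) =
     (\<Union>m \<in> memory_states n A t. \<Union>p \<in> set_pmf (strategy A t m). \<Union>i \<in> set_pmf p.
      \<Union>l \<in> losses n. set_pmf (update A t m p i l))"

text \<open>Space in bits; infinite if the memory states are not of bounded length.\<close>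

definition space_used :: "nat \<Rightarrow> nat \<Rightarrow> algorithm \<Rightarrow> enat" where
  "space_used n T A = (SUP t\<in>{..<T}. SUP m\<in>memory_states n A t. enat (length m))"

end

theory Submission
  imports Defs
begin

text \<open>
  Group the experts into \<open>N = n div 2\<close> pairs and hide a set \<open>X\<close> that contains one expert of each
  pair. Let \<open>k\<close> be about \<open>3 N / 4\<close>. Against the strategy \<open>p\<close> the adversary charges every expert
  outside \<open>X\<close> and the \<open>k\<close> experts of \<open>X\<close> that are heaviest under \<open>p\<close>. This is a best response in
  a zero-sum game of value \<open>k / N\<close>: the algorithm pays at least \<open>k / N\<close> every day, and the average
  expert of \<open>X\<close> pays exactly that. So low regret forces the strategy to be nearly optimal for \<open>X\<close>
  on most days. A strategy nearly optimal for both \<open>X\<close> and \<open>Y\<close> has almost all its mass on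
  \<open>X \<inter> Y\<close>, and no \<open>k\<close> experts of \<open>X\<close> can carry that much; hence \<open>X\<close> and \<open>Y\<close> agree on more
  than \<open>k\<close> pairs, and each strategy is nearly optimal for only a fraction \<open>(9/10) ^ N\<close> of the
  \<open>2 ^ N\<close> hidden sets. Since the strategy depends only on the day, the memory state and fresh
  coins, averaging over \<open>X\<close> shows that about \<open>(10/9) ^ N\<close> memory states are needed.
\<close>

section \<open>The heaviest experts under a strategy\<close>

definition heaviest :: "nat pmf \<Rightarrow> nat set \<Rightarrow> nat \<Rightarrow> nat set" where
  "heaviest p X k = (SOME K. K \<subseteq> X \<and> card K = k \<and>
     (\<forall>L. L \<subseteq> X \<longrightarrow> card L = k \<longrightarrow> sum (pmf p) L \<le> sum (pmf p) K))"

lemma heaviest: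
  assumes "finite X" "k \<le> card X"
  shows heaviest_subset: "heaviest p X k \<subseteq> X"
    and card_heaviest: "card (heaviest p X k) = k"
    and heaviest_max: "L \<subseteq> X \<Longrightarrow> card L = k \<Longrightarrow> sum (pmf p) L \<le> sum (pmf p) (heaviest p X k)"
proof -
  let ?S = "{K. K \<subseteq> X \<and> card K = k}"
  have "finite ?S" using assms(1) by simp
  moreover have "?S \<noteq> {}" using obtain_subset_with_card_n[OF assms(2)] by blast
  ultimately obtain K where K: "K \<in> ?S" "Max (sum (pmf p) ` ?S) = sum (pmf p) K"
    by (rule obtains_MAX)
  have max: "sum (pmf p) L \<le> sum (pmf p) K" if "L \<in> ?S" for L
    using that \<open>finite ?S\<close> unfolding K(2)[symmetric] by (intro Max_ge) auto
  have "\<exists>K. K \<subseteq> X \<and> card K = k \<and>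
     (\<forall>L. L \<subseteq> X \<longrightarrow> card L = k \<longrightarrow> sum (pmf p) L \<le> sum (pmf p) K)"
    using K(1) max by blast
  from someI_ex[OF this, folded heaviest_def]
  show "heaviest p X k \<subseteq> X" "card (heaviest p X k) = k"
    "L \<subseteq> X \<Longrightarrow> card L = k \<Longrightarrow> sum (pmf p) L \<le> sum (pmf p) (heaviest p X k)"
    by auto
qed

lemma heaviest_max_le:
  assumes "finite X" "k \<le> card X" "L \<subseteq> X" "card L \<le> k"
  shows "sum (pmf p) L \<le> sum (pmf p) (heaviest p X k)"
proof -
  obtain M where M: "L \<subseteq> M" "M \<subseteq> X" "card M = k"
    using exists_subset_between[OF assms(4,2,3,1)] by blast
  then have "sum (pmf p) L \<le> sum (pmf p) M"
    by (intro sum_mono2) (auto intro: finite_subset[OF _ assms(1)])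
  also have "\<dots> \<le> sum (pmf p) (heaviest p X k)"
    using heaviest_max assms M by blast
  finally show ?thesis .
qed

text \<open>Exchange argument: swapping a member of the heaviest \<open>k\<close> for an outsider in
  \<open>X\<close> cannot increase the sum, so no outsider outweighs a member. Adding this up over
  all such pairs compares the two averages.\<close>

lemma heaviest_ge_average:
  assumes "finite X" "k \<le> card X"
  shows "real k * sum (pmf p) X \<le> real (card X) * sum (pmf p) (heaviest p X k)"
proof -
  define K where "K = heaviest p X k"
  have K: "K \<subseteq> X" "card K = k"
    using heaviest_subset[OF assms] card_heaviest[OF assms] unfolding K_def by auto
  have fin: "finite K" "finite (X - K)"
    using finite_subset[OF K(1) assms(1)] assms(1) by auto
  have exchange: "pmf p j \<le> pmf p i" if ij: "i \<in> K" "j \<in> X - K" for i j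
  proof -
    have "card (insert j (K - {i})) = k"
      using ij K fin card_Suc_Diff1[of K i] by auto
    moreover have "insert j (K - {i}) \<subseteq> X" using ij K by auto
    ultimately have "sum (pmf p) (insert j (K - {i})) \<le> sum (pmf p) K"
      using heaviest_max[OF assms] unfolding K_def by blast
    moreover have "sum (pmf p) (insert j (K - {i})) = pmf p j + (sum (pmf p) K - pmf p i)"
      using ij fin by (simp add: sum_diff1)
    ultimately show ?thesis by simp
  qed
  have "(\<Sum>i\<in>K. \<Sum>j\<in>X - K. pmf p j) \<le> (\<Sum>i\<in>K. \<Sum>j\<in>X - K. pmf p i)"
    by (intro sum_mono exchange) auto
  then have "real k * sum (pmf p) (X - K) \<le> real (card (X - K)) * sum (pmf p) K"
    using K by (simp add: sum_distrib_left)
  also have "real (card (X - K)) = real (card X) - real k"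
    using K fin assms by (simp add: card_Diff_subset of_nat_diff)
  finally have "real k * sum (pmf p) (X - K) \<le> (real (card X) - real k) * sum (pmf p) K" .
  moreover have "sum (pmf p) X = sum (pmf p) K + sum (pmf p) (X - K)"
    using K assms(1) by (metis add.commute sum.subset_diff)
  ultimately show ?thesis unfolding K_def[symmetric] by (simp add: algebra_simps)
qed

section \<open>Cost of a strategy, and strategies nearly optimal for two sets\<close>

text \<open>Expected loss of the strategy against the best response of the adversary.\<close>

definition cost :: "nat pmf \<Rightarrow> nat set \<Rightarrow> nat \<Rightarrow> real" where
  "cost p X k = 1 - sum (pmf p) X + sum (pmf p) (heaviest p X k)"

lemma sum_pmf_le_1: "finite X \<Longrightarrow> sum (pmf p) X \<le> 1"
  by (metis measure_measure_pmf_finite measure_pmf.prob_le_1)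

text \<open>Mass off \<open>X\<close> pays 1 per unit, mass on \<open>X\<close> at least
  \<open>k / card X\<close> per unit on average. The first bound keeps the mass on \<open>X\<close>
  explicit, so that a low cost forces this mass to be large; the second is the value of the
  game.\<close>

lemma cost_bounds:
  assumes "finite X" "k < card X"
  shows "1 - sum (pmf p) X * (1 - real k / card X) \<le> cost p X k"
    and "real k / card X \<le> cost p X k"
proof -
  have "real k * sum (pmf p) X / card X \<le> sum (pmf p) (heaviest p X k)"
    using heaviest_ge_average[of X k p] assms by (simp add: divide_le_eq mult.commute)
  then show 1: "1 - sum (pmf p) X * (1 - real k / card X) \<le> cost p X k"
    unfolding cost_def by (simp add: algebra_simps)
  have "sum (pmf p) X * (1 - real k / card X) \<le> 1 * (1 - real k / card X)"
    using assms sum_pmf_le_1 by (intro mult_right_mono) auto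
  with 1 show "real k / card X \<le> cost p X k" by simp
qed

text \<open>The excess cost is at least \<open>d \<ge> 1/4\<close> times the mass missing from the
  set, so an excess of \<open>1/40\<close> leaves mass at least \<open>9/10\<close> on each set. If
  \<open>X \<inter> Y\<close> had at most \<open>k\<close> members, the heaviest \<open>k\<close>
  experts of \<open>X\<close> would weigh at least as much as \<open>X \<inter> Y\<close>, and the
  cost for \<open>X\<close> would be at least the mass of \<open>Y\<close>. But it is at most
  \<open>3/4 + 1/40\<close>, below \<open>9/10\<close>.\<close>

lemma cheap_for_two_sets:
  assumes "finite X" "finite Y" "card X = N" "card Y = N" "4 * k \<le> 3 * N" "N > 0"
    and X: "cost p X k \<le> real k / N + 1/40" and Y: "cost p Y k \<le> real k / N + 1/40"
  shows "k < card (X \<inter> Y)"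
proof (rule ccontr)
  assume "\<not> k < card (X \<inter> Y)"
  then have small: "card (X \<inter> Y) \<le> k" by simp
  define d where "d = 1 - real k / N"
  have d: "d \<ge> 1/4" using assms(5,6) unfolding d_def by (simp add: field_simps)
  have k: "k < N" using assms(5,6) by simp
  have mass: "sum (pmf p) Z \<ge> 9/10"
    if "finite Z" "card Z = N" "cost p Z k \<le> real k / N + 1/40" for Z
  proof -
    have "1 - sum (pmf p) Z * d \<le> 1 - d + 1/40"
      using cost_bounds(1)[of Z k p] that k unfolding d_def by simp
    then have "d * (1 - sum (pmf p) Z) \<le> 1/40" by (simp add: algebra_simps)
    moreover have "1/4 * (1 - sum (pmf p) Z) \<le> d * (1 - sum (pmf p) Z)"
      using d sum_pmf_le_1[OF that(1), of p] by (intro mult_right_mono) auto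
    ultimately show ?thesis by simp
  qed
  have "sum (pmf p) (X \<union> Y) + sum (pmf p) (X \<inter> Y) = sum (pmf p) X + sum (pmf p) Y"
    using assms by (simp add: sum.union_inter)
  then have "sum (pmf p) (X \<inter> Y) \<ge> sum (pmf p) X + sum (pmf p) Y - 1"
    using sum_pmf_le_1[of "X \<union> Y" p] assms(1,2) by simp
  moreover have "sum (pmf p) (X \<inter> Y) \<le> sum (pmf p) (heaviest p X k)"
    using assms k small by (intro heaviest_max_le) auto
  ultimately have "sum (pmf p) Y \<le> cost p X k" unfolding cost_def by simp
  then show False using X mass[OF assms(2,4) Y] d unfolding d_def by simp
qed

section \<open>Hidden sets, and how few of them one strategy serves\<close>

text \<open>Pair \<open>j\<close> consists of the experts \<open>2 * j\<close> and
  \<open>2 * j + 1\<close>; the bit \<open>f j\<close> selects the hidden one.\<close>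

definition hidden_set :: "nat \<Rightarrow> (nat \<Rightarrow> nat) \<Rightarrow> nat set" where
  "hidden_set N f = (\<lambda>j. 2 * j + f j) ` {..<N}"

abbreviation choices :: "nat \<Rightarrow> (nat \<Rightarrow> nat) set" where
  "choices N \<equiv> {..<N} \<rightarrow>\<^sub>E {0, 1}"

lemma finite_choices: "finite (choices N)"
  by (rule finite_PiE) auto

lemma card_choices: "card (choices N) = 2 ^ N"
  by (simp add: card_PiE numeral_2_eq_2)

lemma choices_cases: "f \<in> choices N \<Longrightarrow> j < N \<Longrightarrow> f j = 0 \<or> f j = 1"
  by (drule PiE_mem[of _ _ _ j]) auto

lemma choices_le_1: "f \<in> choices N \<Longrightarrow> j < N \<Longrightarrow> f j \<le> 1"
  by (drule (1) choices_cases) auto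

lemma hidden_index_eq:
  assumes "f \<in> choices N" "g \<in> choices N" "i < N" "j < N" "2 * i + f i = 2 * j + g j"
  shows "i = j" "f j = g j"
proof -
  have "f i \<le> 1" "g j \<le> 1" using choices_le_1 assms by blast+
  with assms(5) show "i = j" by linarith
  with assms(5) show "f j = g j" by simp
qed

lemma finite_hidden_set: "finite (hidden_set N f)"
  by (simp add: hidden_set_def)

text \<open>Members of different pairs are distinct, so overlaps of hidden sets become agreements of
  choice functions, which can be counted pair by pair.\<close>

lemma card_hidden_set_Int:
  assumes "f \<in> choices N" "g \<in> choices N"
  shows "card (hidden_set N f \<inter> hidden_set N g) = card {j \<in> {..<N}. f j = g j}"
proof -
  have "hidden_set N f \<inter> hidden_set N g = (\<lambda>j. 2 * j + f j) ` {j \<in> {..<N}. f j = g j}"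
  proof (intro equalityI subsetI)
    fix e assume "e \<in> hidden_set N f \<inter> hidden_set N g"
    then obtain i j where ij: "i < N" "e = 2 * i + f i" "j < N" "e = 2 * j + g j"
      by (auto simp: hidden_set_def)
    with hidden_index_eq[OF assms, of i j] have "j < N" "f j = g j" "e = 2 * j + f j" by auto
    then show "e \<in> (\<lambda>j. 2 * j + f j) ` {j \<in> {..<N}. f j = g j}" by blast
  next
    fix e assume "e \<in> (\<lambda>j. 2 * j + f j) ` {j \<in> {..<N}. f j = g j}"
    then obtain j where "j < N" "e = 2 * j + f j" "e = 2 * j + g j" by auto
    then show "e \<in> hidden_set N f \<inter> hidden_set N g" unfolding hidden_set_def by blast
  qed
  moreover have "inj_on (\<lambda>j. 2 * j + f j) {j \<in> {..<N}. f j = g j}"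
  proof (rule inj_onI)
    fix i j assume "i \<in> {j \<in> {..<N}. f j = g j}" "j \<in> {j \<in> {..<N}. f j = g j}"
      and "2 * i + f i = 2 * j + f j"
    then show "i = j" by (intro hidden_index_eq(1)[OF assms(1,1), of i j]) auto
  qed
  ultimately show ?thesis by (simp only: card_image)
qed

lemma card_hidden_set: "f \<in> choices N \<Longrightarrow> card (hidden_set N f) = N"
proof -
  assume "f \<in> choices N"
  from card_hidden_set_Int[OF this this] show ?thesis by simp
qed

lemma hidden_set_subset:
  assumes "f \<in> choices N" "2 * N \<le> n"
  shows "hidden_set N f \<subseteq> {..<n}"
proof
  fix i assume "i \<in> hidden_set N f"
  then obtain j where "j < N" "i = 2 * j + f j" by (auto simp: hidden_set_def)
  moreover from this have "f j \<le> 1" using choices_le_1[OF assms(1)] by blast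
  ultimately show "i \<in> {..<n}" using assms(2) by simp
qed

lemma card_large_agreement:
  assumes f: "f \<in> choices N"
  shows "card {g \<in> choices N. k < card (hidden_set N f \<inter> hidden_set N g)} * 3 ^ Suc k \<le> (4::nat) ^ N"
proof -
  let ?G = "{g \<in> choices N. k < card (hidden_set N f \<inter> hidden_set N g)}"
  \<comment> \<open>exponential moment bound: each of the sets counted has weight at least \<open>3 ^ Suc k\<close>,
    and the weights of all sets add up to \<open>(3 + 1) ^ N\<close>\<close>
  let ?w = "\<lambda>g. \<Prod>j<N. if f j = g j then 3 else (1::nat)"
  have "3 ^ Suc k \<le> ?w g" if "g \<in> ?G" for g
  proof -
    have "?w g = 3 ^ card {j \<in> {..<N}. f j = g j}"
      by (simp add: prod.If_cases Int_def)
    moreover have "Suc k \<le> card {j \<in> {..<N}. f j = g j}"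
      using that card_hidden_set_Int[OF f] by auto
    ultimately show ?thesis by (simp only:) (intro power_increasing, auto)
  qed
  then have "card ?G * 3 ^ Suc k \<le> (\<Sum>g\<in>?G. ?w g)"
    by (metis (no_types, lifting) of_nat_id sum_bounded_below)
  also have "\<dots> \<le> (\<Sum>g\<in>choices N. ?w g)"
    by (intro sum_mono2 finite_choices) auto
  also have "\<dots> = (\<Prod>j<N. \<Sum>b\<in>{0, 1}. if f j = b then 3 else 1)"
    by (intro prod_sum_PiE[symmetric]) auto
  also have "\<dots> = (\<Prod>j<N. 4)"
  proof (intro prod.cong refl)
    fix j assume "j \<in> {..<N}"
    then have "f j = 0 \<or> f j = 1" using choices_cases[OF f] by simp
    then show "(\<Sum>b\<in>{0, 1}. if f j = b then 3 else 1) = (4::nat)" by auto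
  qed
  finally show ?thesis by simp
qed

text \<open>Fix one cheap hidden set: every other one overlaps it in more than \<open>k\<close>
  experts, which leaves at most \<open>4 ^ N / 3 ^ Suc k\<close> sets. Here
  \<open>3 ^ Suc k \<ge> (20/9) ^ N\<close>, and \<open>4 / (20/9) = 9/5\<close>.\<close>

lemma card_cheap:
  assumes "N > 0" "k = 3 * N div 4"
  shows "real (card {g \<in> choices N. cost p (hidden_set N g) k \<le> real k / N + 1/40}) \<le> (9/5) ^ N"
proof (cases "{g \<in> choices N. cost p (hidden_set N g) k \<le> real k / N + 1/40} = {}")
  case True
  then show ?thesis by (simp only: card.empty) simp
next
  case False
  then obtain f where f: "f \<in> choices N" "cost p (hidden_set N f) k \<le> real k / N + 1/40"
    by blast
  have k: "4 * k \<le> 3 * N" "3 * N \<le> 4 * Suc k" using assms(2) by auto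
  let ?G = "{g \<in> choices N. k < card (hidden_set N f \<inter> hidden_set N g)}"
  have "{g \<in> choices N. cost p (hidden_set N g) k \<le> real k / N + 1/40} \<subseteq> ?G"
  proof safe
    fix g assume "g \<in> choices N" "cost p (hidden_set N g) k \<le> real k / N + 1/40"
    with f k(1) assms(1) show "k < card (hidden_set N f \<inter> hidden_set N g)"
      by (intro cheap_for_two_sets[of _ _ N _ p] finite_hidden_set card_hidden_set)
  qed
  then have "card {g \<in> choices N. cost p (hidden_set N g) k \<le> real k / N + 1/40} \<le> card ?G"
    using finite_choices by (intro card_mono) auto
  moreover have "real (card ?G) \<le> (9/5) ^ N"
  proof -
    \<comment> \<open>Fourth powers avoid the fractional exponent \<open>3 * N / 4\<close>; the
      numerical fact is \<open>(20/9) ^ 4 \<le> 27\<close>.\<close>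
    have "((20/9) ^ N) ^ 4 = ((20/9::real) ^ 4) ^ N"
      by (simp only: power_mult[symmetric] mult.commute[of 4])
    also have "\<dots> \<le> (27::real) ^ N" by (intro power_mono) (auto simp: field_simps)
    also have "\<dots> = 3 ^ (3 * N)" by (simp add: power_mult)
    also have "\<dots> \<le> 3 ^ (4 * Suc k)" using k(2) by (intro power_increasing) auto
    also have "\<dots> = (3 ^ Suc k) ^ 4" by (simp only: power_mult[symmetric] mult.commute[of 4])
    finally have "(20/9) ^ N \<le> (3::real) ^ Suc k"
      by (rule power_le_imp_le_base[where n = 3, simplified]) auto
    have "real (card ?G) * (20/9) ^ N \<le> real (card ?G) * 3 ^ Suc k"
      using \<open>(20/9) ^ N \<le> _\<close> by (intro mult_left_mono) auto
    also have "\<dots> = real (card ?G * 3 ^ Suc k)" by simp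
    also have "\<dots> \<le> real (4 ^ N)"
      using card_large_agreement[OF f(1), of k] by (intro of_nat_mono)
    also have "\<dots> = (9/5) ^ N * (20/9) ^ N" by (simp flip: power_mult_distrib)
    finally show ?thesis by simp
  qed
  ultimately show ?thesis by linarith
qed

section \<open>Counting memory states\<close>

lemma card_bool_lists_le: "card {m :: bool list. length m \<le> S} \<le> 4 ^ S"
proof -
  have "card {m :: bool list. length m \<le> S} = (\<Sum>i\<le>S. 2 ^ i)"
    using card_lists_length_le[of "UNIV :: bool set" S] by (simp add: card_UNIV_bool)
  also have "\<dots> \<le> 4 ^ S"
  proof (induction S)
    case (Suc S)
    have "(2::nat) ^ S \<le> 4 ^ S" by (intro power_mono) auto
    then show ?case using Suc by simp
  qed simp
  finally show ?thesis .
qed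

lemma finite_bool_lists_le: "finite {m :: bool list. length m \<le> S}"
proof -
  have "finite {m :: bool list. set m \<subseteq> UNIV \<and> length m \<le> S}"
    by (rule finite_lists_length_le) simp
  then show ?thesis by simp
qed

text \<open>Since \<open>4 * (9/10) ^ 20 \<le> 1\<close>, twenty pairs per bit outweigh the factor 4
  per bit. The strict inequality leaves one spare factor \<open>9/10\<close>, which later keeps the
  average probability of a cheap strategy away from 1.\<close>

lemma card_memory_bound:
  assumes "20 * S < N"
  shows "real (card {m :: bool list. length m \<le> S}) * (9/5) ^ N \<le> 9/10 * 2 ^ N"
proof -
  obtain d where d: "N = 20 * S + Suc d" using assms less_iff_Suc_add[of "20 * S" N] by auto
  have "4 ^ S * (9/10) ^ N = (4 * (9/10) ^ 20) ^ S * (9/10::real) ^ d * (9/10)"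
    by (simp add: d power_add power_mult power_mult_distrib)
  also have "\<dots> \<le> 1 * 1 * (9/10)"
    by (intro mult_mono power_le_one) (auto simp: field_simps)
  finally have *: "4 ^ S * (9/10::real) ^ N \<le> 9/10" by simp
  have "real (card {m :: bool list. length m \<le> S}) \<le> real (4 ^ S)"
    using card_bool_lists_le by (rule of_nat_mono)
  then have "real (card {m :: bool list. length m \<le> S}) * (9/5) ^ N \<le> 4 ^ S * (9/5) ^ N"
    by (intro mult_right_mono) auto
  also have "\<dots> = (4 ^ S * (9/10) ^ N) * 2 ^ N" by (simp flip: power_mult_distrib)
  also have "\<dots> \<le> 9/10 * 2 ^ N" using * by (intro mult_right_mono) auto
  finally show ?thesis .
qed

section \<open>The loss vectors of the adversary\<close>

text \<open>The restriction to \<open>{..<n}\<close> is there because \<open>losses n\<close>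
  contains extensional functions only.\<close>

definition worst_loss :: "nat \<Rightarrow> nat \<Rightarrow> nat set \<Rightarrow> nat pmf \<Rightarrow> loss" where
  "worst_loss n k X p = (\<lambda>i\<in>{..<n}. of_bool (i \<notin> X \<or> i \<in> heaviest p X k))"

lemma worst_loss_in_losses: "worst_loss n k X p \<in> losses n"
  by (auto simp: losses_def worst_loss_def)

lemma adversary_worst_loss: "(\<lambda>h. worst_loss n k X) \<in> strong_adaptive_adversaries n"
  by (simp add: strong_adaptive_adversaries_def worst_loss_in_losses)

text \<open>The total charged to \<open>X\<close> is the same for every strategy; this caps the loss
  of the best expert in hindsight.\<close>

lemma sum_worst_loss:
  assumes "X \<subseteq> {..<n}" "k \<le> card X"
  shows "(\<Sum>j\<in>X. worst_loss n k X p j) = real k"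
proof -
  have fin: "finite X" using assms(1) finite_subset by blast
  have "(\<Sum>j\<in>X. worst_loss n k X p j) = (\<Sum>j\<in>X. of_bool (j \<in> heaviest p X k))"
    using assms(1) by (intro sum.cong) (auto simp: worst_loss_def)
  also have "\<dots> = real (card (X \<inter> heaviest p X k))"
    using fin by (simp add: sum.If_cases of_bool_def Int_def)
  also have "X \<inter> heaviest p X k = heaviest p X k"
    using heaviest_subset[OF fin assms(2)] by blast
  finally show ?thesis using card_heaviest[OF fin assms(2)] by simp
qed

text \<open>Among the \<open>n\<close> experts, those spared are exactly the members of
  \<open>X\<close> outside the heaviest \<open>k\<close>, so the expected loss is 1 minus their
  mass.\<close>

lemma nn_integral_worst_loss:
  assumes p: "set_pmf p \<subseteq> {..<n}" and X: "finite X" "k \<le> card X"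
  shows "(\<integral>\<^sup>+ i. ennreal (worst_loss n k X p i) \<partial>measure_pmf p) = ennreal (cost p X k)"
proof -
  let ?K = "heaviest p X k"
  have sub: "?K \<subseteq> X" by (rule heaviest_subset[OF X])
  have "(\<integral>\<^sup>+ i. ennreal (worst_loss n k X p i) \<partial>measure_pmf p)
      = (\<integral>\<^sup>+ i. indicator (- (X - ?K)) i \<partial>measure_pmf p)"
    using p by (intro nn_integral_cong_AE AE_pmfI) (auto simp: worst_loss_def indicator_def)
  also have "\<dots> = ennreal (measure_pmf.prob p (- (X - ?K)))"
    by (simp add: measure_pmf.emeasure_eq_measure)
  also have "measure_pmf.prob p (- (X - ?K)) = 1 - measure_pmf.prob p (X - ?K)"
    using measure_pmf.prob_compl[of "X - ?K" p] by (simp add: Compl_eq_Diff_UNIV)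
  also have "measure_pmf.prob p (X - ?K) = sum (pmf p) X - sum (pmf p) ?K"
    using X sub by (simp add: measure_measure_pmf_finite sum_diff)
  finally show ?thesis by (simp add: cost_def algebra_simps)
qed

section \<open>Runs and their expected total loss\<close>

text \<open>Ties the random run to the worst-case state sets that define space. The history
  \<open>h'\<close> is left open, which is enough for adversaries that ignore the past.\<close>

lemma run_support:
  assumes A: "experts_algorithm n A" and adv: "adv \<in> strong_adaptive_adversaries n"
  shows "(m, h) \<in> set_pmf (run A adv t) \<Longrightarrow> m \<in> memory_states n A t \<and> length h = t \<and>
    (\<forall>(p, i, l) \<in> set h. i < n \<and> (\<exists>h'. l = adv h' p))"
proof (induction t arbitrary: m h)
  case 0
  then show ?case by auto
next
  case (Suc t)
  then obtain m0 h0 p i where *: "(m0, h0) \<in> set_pmf (run A adv t)" "p \<in> set_pmf (strategy A t m0)"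
    "i \<in> set_pmf p" "m \<in> set_pmf (update A t m0 p i (adv h0 p))" "h = h0 @ [(p, i, adv h0 p)]"
    by auto
  have "i < n" using A * unfolding experts_algorithm_def by blast
  moreover have "adv h0 p \<in> losses n" using adv by (simp add: strong_adaptive_adversaries_def)
  ultimately show ?case using Suc.IH[OF *(1)] * by (auto 0 4)
qed

text \<open>
  The total loss is bounded only on the support of \<open>run\<close>; with values in \<open>ennreal\<close> the
  recursion for its expectation needs no integrability.
\<close>

definition total_loss :: "transcript \<Rightarrow> ennreal" where
  "total_loss h = (\<Sum>(p, i, l)\<leftarrow>h. ennreal (l i))"

lemma nn_integral_total_loss_Suc:
  "(\<integral>\<^sup>+ (m, h). total_loss h \<partial>measure_pmf (run A adv (Suc t))) =
     (\<integral>\<^sup>+ (m, h). total_loss h \<partial>measure_pmf (run A adv t)) +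
     (\<integral>\<^sup>+ (m, h). (\<integral>\<^sup>+ p. (\<integral>\<^sup>+ i. ennreal (adv h p i) \<partial>measure_pmf p)
        \<partial>measure_pmf (strategy A t m)) \<partial>measure_pmf (run A adv t))"
proof -
  have "(\<integral>\<^sup>+ (m, h). total_loss h \<partial>measure_pmf (run A adv (Suc t))) =
    (\<integral>\<^sup>+ (m, h). (\<integral>\<^sup>+ p. (\<integral>\<^sup>+ i. total_loss h + ennreal (adv h p i) \<partial>measure_pmf p)
        \<partial>measure_pmf (strategy A t m)) \<partial>measure_pmf (run A adv t))"
    by (simp add: case_prod_unfold total_loss_def)
  also have "\<dots> = (\<integral>\<^sup>+ (m, h). total_loss h + (\<integral>\<^sup>+ p. (\<integral>\<^sup>+ i. ennreal (adv h p i) \<partial>measure_pmf p)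
        \<partial>measure_pmf (strategy A t m)) \<partial>measure_pmf (run A adv t))"
    by (simp add: nn_integral_add measure_pmf.emeasure_space_1)
  finally show ?thesis by (simp add: nn_integral_add case_prod_unfold)
qed

section \<open>Cheap strategies: what they save and how rare they are\<close>

abbreviation cheap :: "nat \<Rightarrow> nat set \<Rightarrow> nat pmf set" where
  "cheap k X \<equiv> {p. cost p X k \<le> real k / card X + 1/40}"

abbreviation cheap_prob :: "algorithm \<Rightarrow> nat \<Rightarrow> nat \<Rightarrow> nat set \<Rightarrow> nat \<Rightarrow> ennreal" where
  "cheap_prob A n k X t \<equiv> (\<integral>\<^sup>+ (m, h). emeasure (measure_pmf (strategy A t m)) (cheap k X)
     \<partial>measure_pmf (run A (\<lambda>h. worst_loss n k X) t))"

text \<open>Holds for each \<open>p\<close> separately: a strategy that is not cheap pays the left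
  side in full, and for a cheap one the indicator supplies the missing \<open>1/40\<close>, since no
  strategy pays less than \<open>k / card X\<close>. The correction is added on the right because
  subtraction in \<open>ennreal\<close> truncates.\<close>

lemma day_loss_ge:
  assumes A: "experts_algorithm n A" and X: "finite X" "k < card X"
  shows "ennreal (real k / card X + 1/40) \<le>
    (\<integral>\<^sup>+ p. (\<integral>\<^sup>+ i. ennreal (worst_loss n k X p i) \<partial>measure_pmf p) \<partial>measure_pmf (strategy A t m)) +
    ennreal (1/40) * emeasure (measure_pmf (strategy A t m)) (cheap k X)"
proof -
  let ?v = "real k / card X + 1/40"
  have "ennreal ?v = (\<integral>\<^sup>+ p. ennreal ?v \<partial>measure_pmf (strategy A t m))"
    by (simp add: measure_pmf.emeasure_space_1)
  also have "\<dots> \<le> (\<integral>\<^sup>+ p. (\<integral>\<^sup>+ i. ennreal (worst_loss n k X p i) \<partial>measure_pmf p) +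
      ennreal (1/40) * indicator (cheap k X) p \<partial>measure_pmf (strategy A t m))"
  proof (intro nn_integral_mono_AE AE_pmfI)
    fix p assume "p \<in> set_pmf (strategy A t m)"
    then have "set_pmf p \<subseteq> {..<n}" using A unfolding experts_algorithm_def by blast
    then have *: "(\<integral>\<^sup>+ i. ennreal (worst_loss n k X p i) \<partial>measure_pmf p) = ennreal (cost p X k)"
      using X by (intro nn_integral_worst_loss) auto
    have low: "real k / card X \<le> cost p X k" by (rule cost_bounds(2)[OF X])
    show "ennreal ?v \<le> (\<integral>\<^sup>+ i. ennreal (worst_loss n k X p i) \<partial>measure_pmf p) +
      ennreal (1/40) * indicator (cheap k X) p"
    proof (cases "p \<in> cheap k X")
      case True
      have "ennreal ?v \<le> ennreal (cost p X k + 1/40)" using low by (intro ennreal_leI) simp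
      also have "\<dots> = ennreal (cost p X k) + ennreal (1/40)"
        using low order_trans[OF _ low, of 0] by (intro ennreal_plus) auto
      finally show ?thesis using True * by simp
    next
      case False
      then have "ennreal ?v \<le> ennreal (cost p X k)" by (intro ennreal_leI) simp
      then show ?thesis using False * by simp
    qed
  qed
  also have "\<dots> = (\<integral>\<^sup>+ p. (\<integral>\<^sup>+ i. ennreal (worst_loss n k X p i) \<partial>measure_pmf p) \<partial>measure_pmf (strategy A t m)) +
    ennreal (1/40) * emeasure (measure_pmf (strategy A t m)) (cheap k X)"
    by (simp add: nn_integral_add nn_integral_cmult)
  finally show ?thesis .
qed

lemma total_loss_ge:
  assumes A: "experts_algorithm n A" and X: "finite X" "k < card X"
  shows "of_nat t * ennreal (real k / card X + 1/40) \<le>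
    (\<integral>\<^sup>+ (m, h). total_loss h \<partial>measure_pmf (run A (\<lambda>h. worst_loss n k X) t)) +
    ennreal (1/40) * (\<Sum>s<t. cheap_prob A n k X s)"
proof (induction t)
  case (Suc t)
  let ?v = "ennreal (real k / card X + 1/40)"
  let ?r = "measure_pmf (run A (\<lambda>h. worst_loss n k X) t)"
  let ?l = "\<lambda>m. \<integral>\<^sup>+ p. (\<integral>\<^sup>+ i. ennreal (worst_loss n k X p i) \<partial>measure_pmf p) \<partial>measure_pmf (strategy A t m)"
  have "?v = (\<integral>\<^sup>+ (m, h). ?v \<partial>?r)"
    by (simp add: case_prod_unfold measure_pmf.emeasure_space_1)
  also have "\<dots> \<le> (\<integral>\<^sup>+ (m, h). ?l m +
    ennreal (1/40) * emeasure (measure_pmf (strategy A t m)) (cheap k X) \<partial>?r)"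
    using day_loss_ge[OF A X] by (intro nn_integral_mono) (simp add: case_prod_unfold)
  also have "\<dots> = (\<integral>\<^sup>+ (m, h). ?l m \<partial>?r) + ennreal (1/40) * cheap_prob A n k X t"
    by (simp add: nn_integral_add nn_integral_cmult case_prod_unfold)
  finally have "?v + of_nat t * ?v \<le>
    ((\<integral>\<^sup>+ (m, h). ?l m \<partial>?r) + ennreal (1/40) * cheap_prob A n k X t) +
    ((\<integral>\<^sup>+ (m, h). total_loss h \<partial>?r) + ennreal (1/40) * (\<Sum>s<t. cheap_prob A n k X s))"
    using Suc.IH by (intro add_mono)
  then show ?case
    unfolding nn_integral_total_loss_Suc by (simp add: algebra_simps)
qed simp

text \<open>The law of the memory state depends on the hidden set, but the law of the strategy given
  the state does not. A union bound over \<open>M\<close> removes the first dependence; for a fixed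
  state, \<open>card_cheap\<close> then applies to each strategy in its support.\<close>

lemma sum_cheap_prob_le:
  assumes A: "experts_algorithm n A" and "N > 0" "k = 3 * N div 4"
    and M: "finite M" "memory_states n A t \<subseteq> M"
  shows "(\<Sum>f\<in>choices N. cheap_prob A n k (hidden_set N f) t) \<le> ennreal (card M * (9/5) ^ N)"
proof -
  let ?\<phi> = "\<lambda>f m. emeasure (measure_pmf (strategy A t m)) (cheap k (hidden_set N f))"
  have "(\<Sum>f\<in>choices N. cheap_prob A n k (hidden_set N f) t) \<le> (\<Sum>f\<in>choices N. \<Sum>m\<in>M. ?\<phi> f m)"
  proof (rule sum_mono)
    fix f
    let ?q = "map_pmf fst (run A (\<lambda>h. worst_loss n k (hidden_set N f)) t)"
    have "set_pmf ?q \<subseteq> M"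
      using run_support[OF A adversary_worst_loss] M(2) by auto
    then have "(\<integral>\<^sup>+ m. ?\<phi> f m \<partial>measure_pmf ?q) = (\<Sum>m\<in>M. ?\<phi> f m * ennreal (pmf ?q m))"
      by (intro nn_integral_measure_pmf_support M(1)) auto
    \<comment> \<open>The state probability is the only factor that involves the run against
      \<open>f\<close>; it is replaced by 1.\<close>
    also have "\<dots> \<le> (\<Sum>m\<in>M. ?\<phi> f m * 1)"
      by (intro sum_mono mult_left_mono) (auto simp: pmf_le_1)
    finally show "cheap_prob A n k (hidden_set N f) t \<le> (\<Sum>m\<in>M. ?\<phi> f m)"
      by (simp add: case_prod_unfold)
  qed
  also have "\<dots> = (\<Sum>m\<in>M. \<Sum>f\<in>choices N. ?\<phi> f m)" by (rule sum.swap)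
  also have "\<dots> \<le> (\<Sum>m\<in>M. ennreal ((9/5) ^ N))"
  proof (rule sum_mono)
    fix m
    have "(\<Sum>f\<in>choices N. ?\<phi> f m) =
      (\<integral>\<^sup>+ p. (\<Sum>f\<in>choices N. indicator (cheap k (hidden_set N f)) p) \<partial>measure_pmf (strategy A t m))"
      by (subst nn_integral_sum) auto
    also have "\<dots> \<le> (\<integral>\<^sup>+ p. ennreal ((9/5) ^ N) \<partial>measure_pmf (strategy A t m))"
    proof (rule nn_integral_mono)
      fix p
      have "(\<Sum>f\<in>choices N. indicator (cheap k (hidden_set N f)) p) =
        (\<Sum>f\<in>choices N. if cost p (hidden_set N f) k \<le> real k / N + 1/40 then 1 else (0::ennreal))"
        by (intro sum.cong) (auto simp: card_hidden_set)
      also have "\<dots> = ennreal (card {f \<in> choices N. cost p (hidden_set N f) k \<le> real k / N + 1/40})"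
        using finite_choices by (simp add: sum.If_cases Int_def ennreal_of_nat_eq_real_of_nat)
      also have "\<dots> \<le> ennreal ((9/5) ^ N)"
        using card_cheap[OF assms(2,3)] by (intro ennreal_leI)
      finally show "(\<Sum>f\<in>choices N. indicator (cheap k (hidden_set N f)) p) \<le> ennreal ((9/5) ^ N)" .
    qed
    also have "\<dots> = ennreal ((9/5) ^ N)" by (simp add: measure_pmf.emeasure_space_1)
    finally show "(\<Sum>f\<in>choices N. ?\<phi> f m) \<le> ennreal ((9/5) ^ N)" .
  qed
  also have "\<dots> = ennreal (card M * (9/5) ^ N)"
    by (simp add: ennreal_of_nat_eq_real_of_nat ennreal_mult')
  finally show ?thesis .
qed

section \<open>From total loss to regret\<close>

lemma sum_list_map_bounds:
  fixes f :: "'a \<Rightarrow> real"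
  assumes "\<And>x. x \<in> set xs \<Longrightarrow> 0 \<le> f x \<and> f x \<le> 1"
  shows "0 \<le> (\<Sum>x\<leftarrow>xs. f x)" "(\<Sum>x\<leftarrow>xs. f x) \<le> length xs"
proof -
  show "0 \<le> (\<Sum>x\<leftarrow>xs. f x)" using assms by (intro sum_list_nonneg) auto
  show "(\<Sum>x\<leftarrow>xs. f x) \<le> length xs" using assms by (induction xs) fastforce+
qed

lemma transcript_loss_bounds:
  assumes "\<And>p i l. (p, i, l) \<in> set h \<Longrightarrow> i < n \<and> l \<in> losses n"
  shows "0 \<le> algorithm_loss h" "algorithm_loss h \<le> length h"
    "j < n \<Longrightarrow> 0 \<le> expert_loss h j"
    "total_loss h = ennreal (algorithm_loss h)"
proof -
  have expert: "0 \<le> l j \<and> l j \<le> 1" if "(p, i, l) \<in> set h" "j < n" for p i l j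
    using assms[OF that(1)] that(2) PiE_mem[of l "{..<n}" "\<lambda>_. {0..1}" j] unfolding losses_def by simp
  have played: "0 \<le> l i \<and> l i \<le> 1" if "(p, i, l) \<in> set h" for p i l
    using expert[OF that] assms[OF that] by blast
  have "0 \<le> (case x of (p, i, l) \<Rightarrow> l i) \<and> (case x of (p, i, l) \<Rightarrow> l i) \<le> 1" if "x \<in> set h" for x
    using played that by (auto split: prod.split)
  from sum_list_map_bounds[of h "\<lambda>(p, i, l). l i", OF this]
  show "0 \<le> algorithm_loss h" "algorithm_loss h \<le> length h"
    unfolding algorithm_loss_def by simp_all
  show "0 \<le> expert_loss h j" if "j < n"
  proof -
    have "0 \<le> (case x of (p, i, l) \<Rightarrow> l j) \<and> (case x of (p, i, l) \<Rightarrow> l j) \<le> 1" if "x \<in> set h" for x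
      using expert that \<open>j < n\<close> by (auto split: prod.split)
    from sum_list_map_bounds(1)[of h "\<lambda>(p, i, l). l j", OF this] show ?thesis unfolding expert_loss_def by simp
  qed
  \<comment> \<open>Restated for any transcript with nonnegative played losses, a condition that
    passes to tails in the induction.\<close>
  have "total_loss h = ennreal (algorithm_loss h) \<and> 0 \<le> algorithm_loss h"
    if "\<And>p i l. (p, i, l) \<in> set h \<Longrightarrow> 0 \<le> l i" for h :: transcript
    using that
  proof (induction h)
    case (Cons a h)
    obtain p i l where a: "a = (p, i, l)" by (cases a)
    have "0 \<le> l i" using Cons.prems[of p i l] a by simp
    moreover have "total_loss h = ennreal (algorithm_loss h) \<and> 0 \<le> algorithm_loss h"
      using Cons by (meson list.set_intros(2))
    ultimately show ?case by (simp add: total_loss_def algorithm_loss_def a)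
  qed (simp add: total_loss_def algorithm_loss_def)
  then show "total_loss h = ennreal (algorithm_loss h)" using played by blast
qed

text \<open>The minimum over all experts is at most the average over \<open>X\<close>, which the
  constant daily sum \<open>c\<close> determines.\<close>

lemma Min_expert_loss_le:
  assumes X: "X \<subseteq> {..<n}" "X \<noteq> {}"
    and l: "\<And>p i l. (p, i, l) \<in> set h \<Longrightarrow> (\<Sum>j\<in>X. l j) = c"
  shows "Min (expert_loss h ` {..<n}) \<le> c * length h / card X"
proof -
  have fin: "finite X" using X(1) finite_subset by blast
  have "(\<Sum>j\<in>X. expert_loss h j) = c * length h"
    using l
  proof (induction h)
    case (Cons a h)
    obtain p i l where a: "a = (p, i, l)" by (cases a)
    have "(\<Sum>j\<in>X. l j) = c" using Cons.prems[of p i l] a by simp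
    moreover have "(\<Sum>j\<in>X. expert_loss h j) = c * length h"
      using Cons by (meson list.set_intros(2))
    ultimately show ?case by (simp add: expert_loss_def a sum.distrib algebra_simps)
  qed (simp add: expert_loss_def)
  moreover have "card X * Min (expert_loss h ` {..<n}) \<le> (\<Sum>j\<in>X. expert_loss h j)"
    using X by (intro sum_bounded_below Min_le) auto
  moreover have "card X > 0" using fin X(2) by (simp add: card_gt_0_iff)
  ultimately show ?thesis by (simp add: pos_le_divide_eq mult.commute)
qed

text \<open>The expected loss is the regret plus the expected loss of the best expert, and the
  latter is at most \<open>k / card X\<close> per day.\<close>

lemma total_loss_le_regret:
  assumes A: "experts_algorithm n A" and X: "X \<subseteq> {..<n}" "k < card X"
  defines "adv \<equiv> (\<lambda>h. worst_loss n k X)"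
  shows "(\<integral>\<^sup>+ (m, h). total_loss h \<partial>measure_pmf (run A adv t)) \<le>
    ennreal (regret n t A adv + real k / card X * t)"
proof -
  let ?M = "measure_pmf (run A adv t)"
  let ?min = "\<lambda>h. Min (expert_loss h ` {..<n})"
  let ?v = "real k / card X * t"
  have adv: "adv \<in> strong_adaptive_adversaries n"
    unfolding adv_def by (rule adversary_worst_loss)
  have "X \<noteq> {}" using X(2) by auto
  then have n: "{..<n} \<noteq> {}" using X(1) by auto
  have supp: "0 \<le> algorithm_loss h \<and> algorithm_loss h \<le> t \<and> total_loss h = ennreal (algorithm_loss h)
      \<and> 0 \<le> ?min h \<and> ?min h \<le> ?v"
    if "(m, h) \<in> set_pmf (run A adv t)" for m h
  proof -
    have h: "length h = t" "\<And>p i l. (p, i, l) \<in> set h \<Longrightarrow> i < n \<and> (\<exists>h'. l = adv h' p)"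
      using run_support[OF A adv that] by auto
    have l: "i < n \<and> l \<in> losses n \<and> (\<Sum>j\<in>X. l j) = real k" if "(p, i, l) \<in> set h" for p i l
      using h(2)[OF that] X worst_loss_in_losses sum_worst_loss[of X n k p]
      unfolding adv_def by auto
    have "?min h \<le> ?v"
      using Min_expert_loss_le[OF X(1) \<open>X \<noteq> {}\<close>, of h "real k"] l h(1) by auto
    moreover have "0 \<le> ?min h"
      using n transcript_loss_bounds(3)[of h n] l by (subst Min_ge_iff) auto
    moreover have "0 \<le> algorithm_loss h" "algorithm_loss h \<le> t" "total_loss h = ennreal (algorithm_loss h)"
      using transcript_loss_bounds[of h n] l h(1) by blast+
    ultimately show ?thesis by simp
  qed
  \<comment> \<open>Boundedness on the support gives integrability, without which the expectation in
    \<open>regret\<close> could not be split.\<close>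
  have int_alg: "integrable ?M (\<lambda>(m, h). algorithm_loss h)"
    using supp by (intro measure_pmf.integrable_const_bound[where B = t] AE_pmfI) auto
  have int_min: "integrable ?M (\<lambda>(m, h). ?min h)"
    using supp by (intro measure_pmf.integrable_const_bound[where B = ?v] AE_pmfI) auto
  have "(\<integral>\<^sup>+ (m, h). total_loss h \<partial>?M) = (\<integral>\<^sup>+ x. ennreal ((\<lambda>(m, h). algorithm_loss h) x) \<partial>?M)"
    using supp by (intro nn_integral_cong_AE AE_pmfI) auto
  also have "\<dots> = ennreal (\<integral>x. (\<lambda>(m, h). algorithm_loss h) x \<partial>?M)"
    using supp int_alg by (intro nn_integral_eq_integral AE_pmfI) auto
  also have "\<dots> \<le> ennreal (regret n t A adv + ?v)"
  proof (rule ennreal_leI)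
    have "(\<integral>x. (\<lambda>(m, h). ?min h) x \<partial>?M) \<le> ?v"
      using supp int_min by (intro measure_pmf.integral_le_const AE_pmfI) auto
    moreover have "regret n t A adv =
      (\<integral>x. (\<lambda>(m, h). algorithm_loss h) x \<partial>?M) - (\<integral>x. (\<lambda>(m, h). ?min h) x \<partial>?M)"
      unfolding regret_def Bochner_Integration.integral_diff[OF int_alg int_min, symmetric]
      by (simp add: case_prod_unfold)
    ultimately show "(\<integral>x. (\<lambda>(m, h). algorithm_loss h) x \<partial>?M) \<le> regret n t A adv + ?v" by simp
  qed
  finally show ?thesis .
qed

section \<open>Averaging over the hidden sets\<close>

text \<open>Averaged over the \<open>2 ^ N\<close> hidden sets, a day's strategy is cheap with
  probability at most \<open>9/10\<close>, so each day loses at least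
  \<open>1/40 * 1/10 = 1/400\<close> above the game value.\<close>

lemma regret_lower_bound:
  assumes A: "experts_algorithm n A" and n: "n \<ge> 2"
    and S: "\<And>t m. t < T \<Longrightarrow> m \<in> memory_states n A t \<Longrightarrow> length m \<le> S" "60 * S < n"
    and r: "0 \<le> r" "\<And>adv. adv \<in> strong_adaptive_adversaries n \<Longrightarrow> regret n T A adv \<le> r"
  shows "real T / 400 \<le> r"
proof -
  define N where "N = n div 2"
  define k where "k = 3 * N div 4"
  let ?M = "{m :: bool list. length m \<le> S}"
  let ?v = "real k / N"
  \<comment> \<open>\<open>60 * S < n\<close> gives \<open>n div 2 \<ge> 30 * S\<close>, and
    \<open>n \<ge> 2\<close> covers \<open>S = 0\<close>.\<close>
  have N: "N > 0" "2 * N \<le> n" "20 * S < N" "k < N" using n S(2) unfolding N_def k_def by auto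
  have X: "finite (hidden_set N f)" "hidden_set N f \<subseteq> {..<n}" "card (hidden_set N f) = N"
    if "f \<in> choices N" for f
    using that finite_hidden_set hidden_set_subset N card_hidden_set by auto
  have "ennreal (2 ^ N * (T * (?v + 1/40))) = (\<Sum>f\<in>choices N. of_nat T * ennreal (?v + 1/40))"
    unfolding sum_constant card_choices
    by (simp add: ennreal_of_nat_eq_real_of_nat ennreal_mult' flip: ennreal_power ennreal_plus)
  also have "\<dots> \<le> (\<Sum>f\<in>choices N. ennreal (r + ?v * T) +
      ennreal (1/40) * (\<Sum>s<T. cheap_prob A n k (hidden_set N f) s))"
  proof (rule sum_mono)
    fix f assume f: "f \<in> choices N"
    let ?adv = "\<lambda>h. worst_loss n k (hidden_set N f)"
    have "of_nat T * ennreal (?v + 1/40) \<le>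
      (\<integral>\<^sup>+ (m, h). total_loss h \<partial>measure_pmf (run A ?adv T)) +
      ennreal (1/40) * (\<Sum>s<T. cheap_prob A n k (hidden_set N f) s)"
      using total_loss_ge[OF A X(1)[OF f], of k T] X(3)[OF f] N(4) by simp
    also have "(\<integral>\<^sup>+ (m, h). total_loss h \<partial>measure_pmf (run A ?adv T)) \<le>
        ennreal (regret n T A ?adv + ?v * T)"
      using total_loss_le_regret[OF A X(2)[OF f], of k T] X(3)[OF f] N(4) by simp
    also have "\<dots> \<le> ennreal (r + ?v * T)"
      using r(2)[OF adversary_worst_loss] by (intro ennreal_leI) simp
    finally show "of_nat T * ennreal (?v + 1/40) \<le> ennreal (r + ?v * T) +
      ennreal (1/40) * (\<Sum>s<T. cheap_prob A n k (hidden_set N f) s)"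
      by (simp add: add_right_mono)
  qed
  also have "\<dots> = ennreal (2 ^ N * (r + ?v * T)) +
      ennreal (1/40) * (\<Sum>s<T. \<Sum>f\<in>choices N. cheap_prob A n k (hidden_set N f) s)"
    unfolding sum.distrib sum_distrib_left[symmetric] sum_constant card_choices
      sum.swap[of _ "{..<T}"]
    by (simp add: ennreal_mult' flip: ennreal_power)
  also have "\<dots> \<le> ennreal (2 ^ N * (r + ?v * T)) + ennreal (1/40) * (\<Sum>s<T. ennreal (9/10 * 2 ^ N))"
  proof (intro add_left_mono mult_left_mono sum_mono)
    fix s assume "s \<in> {..<T}"
    then have "memory_states n A s \<subseteq> ?M" using S(1) by auto
    from sum_cheap_prob_le[OF A N(1) k_def finite_bool_lists_le this]
    have "(\<Sum>f\<in>choices N. cheap_prob A n k (hidden_set N f) s) \<le> ennreal (card ?M * (9/5) ^ N)" .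
    also have "\<dots> \<le> ennreal (9/10 * 2 ^ N)"
      by (intro ennreal_leI card_memory_bound N)
    finally show "(\<Sum>f\<in>choices N. cheap_prob A n k (hidden_set N f) s) \<le> ennreal (9/10 * 2 ^ N)" .
  qed simp
  also have "\<dots> = ennreal (2 ^ N * (r + ?v * T) + 1/40 * (T * (9/10 * 2 ^ N)))"
    using r(1) by (subst ennreal_plus) (auto simp: ennreal_of_nat_eq_real_of_nat simp flip: ennreal_mult')
  finally have "2 ^ N * (T * (?v + 1/40)) \<le> 2 ^ N * (r + ?v * T) + 1/40 * (T * (9/10 * 2 ^ N))"
    using r(1) by (subst (asm) ennreal_le_iff) auto
  also have "\<dots> = 2 ^ N * (r + ?v * T + 9/400 * T)" by (simp add: algebra_simps)
  finally have "T * (?v + 1/40) \<le> r + ?v * T + 9/400 * T" by simp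
  then show ?thesis by (simp add: algebra_simps)
qed

(* The problem instances (n experts, T days, algorithm A with regret at most R) are indexed by
   k = 0, 1, 2, ...; fixed n with T = k, and n and T growing jointly, are both instances.
   The Omega-constant c does not depend on n, T or the algorithm. For a single expert the
   regret is always zero, hence n >= 2. *)
theorem theorem6p11:
  "\<exists>c::real. c > 0 \<and>
     (\<forall>(n :: nat \<Rightarrow> nat) (T :: nat \<Rightarrow> nat) (A :: nat \<Rightarrow> algorithm) (R :: nat \<Rightarrow> real).
        (\<forall>k. n k \<ge> 2 \<and> experts_algorithm (n k) (A k)) \<longrightarrow>
        filterlim T at_top sequentially \<longrightarrow>
        (\<forall>k. \<forall>adv \<in> strong_adaptive_adversaries (n k). regret (n k) (T k) (A k) adv \<le> R k) \<longrightarrow>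
        R \<in> o(\<lambda>k. real (T k)) \<longrightarrow>
        (\<forall>\<^sub>F k in sequentially.
           ereal_of_enat (space_used (n k) (T k) (A k)) \<ge> ereal (c * real (n k))))"
proof (intro exI[of _ "1/60"] conjI allI impI)
  fix n T :: "nat \<Rightarrow> nat" and A :: "nat \<Rightarrow> algorithm" and R :: "nat \<Rightarrow> real"
  assume A: "\<forall>k. n k \<ge> 2 \<and> experts_algorithm (n k) (A k)"
    and T: "filterlim T at_top sequentially"
    and R: "\<forall>k. \<forall>adv \<in> strong_adaptive_adversaries (n k). regret (n k) (T k) (A k) adv \<le> R k"
    and o: "R \<in> o(\<lambda>k. real (T k))"
  have "\<forall>\<^sub>F k in sequentially. norm (R k) \<le> 1/800 * norm (real (T k))"
    \<comment> \<open>Half of the constant \<open>1/400\<close>, so that the two bounds contradict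
      each other once \<open>T k \<ge> 1\<close>.\<close>
    using landau_o.smallD[OF o, of "1/800"] by simp
  moreover have "\<forall>\<^sub>F k in sequentially. T k \<ge> 1"
    using T by (simp add: filterlim_at_top)
  ultimately show "\<forall>\<^sub>F k in sequentially.
    ereal_of_enat (space_used (n k) (T k) (A k)) \<ge> ereal (1/60 * real (n k))"
  proof eventually_elim
    case (elim k)
    show ?case
    proof (rule ccontr)
      assume "\<not> ?case"
      then have less: "ereal_of_enat (space_used (n k) (T k) (A k)) < ereal (1/60 * real (n k))"
        by simp
      \<comment> \<open>Infinite space would satisfy the bound, so the space is finite here.\<close>
      then obtain S where S: "space_used (n k) (T k) (A k) = enat S"
        by (cases "space_used (n k) (T k) (A k)") auto
      have "60 * S < n k" using less unfolding S by simp
      moreover have "length m \<le> S" if "t < T k" "m \<in> memory_states (n k) (A k) t" for t m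
      proof -
        have "enat (length m) \<le> space_used (n k) (T k) (A k)"
          unfolding space_used_def using that by (intro SUP_upper2[of t] SUP_upper2[of m]) auto
        then show ?thesis by (simp add: S)
      qed
      \<comment> \<open>The absolute value supplies the nonnegative regret bound that the
        conversions from \<open>ennreal\<close> require.\<close>
      ultimately have "real (T k) / 400 \<le> \<bar>R k\<bar>"
        using A R by (intro regret_lower_bound[of "n k" "A k" "T k" S]) force+
      then show False using elim by simp
    qed
  qed
qed simp

end
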